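(* If $S$ is a spider in which all but three of its legs have length at most $2$ (that is, there are three legs of $S$ such that every other leg has length at most $2$), then $S$ is graceful.
   Context: For integers $p,q$, $[p,q]=\{i\in\mathbb{Z}: p\le i\le q\}$. A graceful labeling of a graph $G$ is an injective function $f:V(G)\to[0,|E(G)|]$ such that $\{|f(x)-f(y)| : xy\in E(G)\}=[1,|E(G)|]$; $G$ is graceful if it admits one. A spider is a tree with at most one vertex of degree greater than two; when such a vertex exists it is the center, and each path in the spider joining the center to a leaf is called a leg. A leg's length is its number of edges. *)

theory Defs
  imports Main
begin

definition simple_graph :: "'a set \<Rightarrow> 'a set set \<Rightarrow> bool" where
  "simple_graph V E \<longleftrightarrow> finite V \<and> (\<forall>e\<in>E. e \<subseteq> V \<and> card e = 2)"

definition vert_degree :: "'a set set \<Rightarrow> 'a \<Rightarrow> nat" where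
  "vert_degree E v = card {e \<in> E. v \<in> e}"

definition graph_path :: "'a set \<Rightarrow> 'a set set \<Rightarrow> 'a list \<Rightarrow> bool" where
  "graph_path V E p \<longleftrightarrow>
     p \<noteq> [] \<and> set p \<subseteq> V \<and> distinct p \<and> successively (\<lambda>x y. {x, y} \<in> E) p"

text \<open>A path is given by its list of vertices, so it has one edge fewer than vertices.\<close>

definition path_length :: "'a list \<Rightarrow> nat" where
  "path_length p = length p - 1"

definition connected_graph :: "'a set \<Rightarrow> 'a set set \<Rightarrow> bool" where
  "connected_graph V E \<longleftrightarrow>
     V \<noteq> {} \<and> (\<forall>u\<in>V. \<forall>v\<in>V. \<exists>p. graph_path V E p \<and> hd p = u \<and> last p = v)"

text \<open>A cycle is listed without repeating its starting vertex.\<close>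

definition graph_cycle :: "'a set \<Rightarrow> 'a set set \<Rightarrow> 'a list \<Rightarrow> bool" where
  "graph_cycle V E p \<longleftrightarrow> graph_path V E p \<and> length p \<ge> 3 \<and> {last p, hd p} \<in> E"

definition tree_graph :: "'a set \<Rightarrow> 'a set set \<Rightarrow> bool" where
  "tree_graph V E \<longleftrightarrow>
     simple_graph V E \<and> connected_graph V E \<and> (\<nexists>p. graph_cycle V E p)"

definition spider :: "'a set \<Rightarrow> 'a set set \<Rightarrow> bool" where
  "spider V E \<longleftrightarrow> tree_graph V E \<and> card {v \<in> V. vert_degree E v > 2} \<le> 1"

definition spider_center :: "'a set \<Rightarrow> 'a set set \<Rightarrow> 'a \<Rightarrow> bool" where
  "spider_center V E c \<longleftrightarrow> c \<in> V \<and> vert_degree E c > 2"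

definition leaf :: "'a set \<Rightarrow> 'a set set \<Rightarrow> 'a \<Rightarrow> bool" where
  "leaf V E v \<longleftrightarrow> v \<in> V \<and> vert_degree E v = 1"

text \<open>
  Legs are listed starting from the center; since the center is not a leaf, each leg
  corresponds to exactly one such list. A spider without a center has no legs.
\<close>

definition legs :: "'a set \<Rightarrow> 'a set set \<Rightarrow> 'a list set" where
  "legs V E = {p. graph_path V E p \<and> spider_center V E (hd p) \<and> leaf V E (last p)}"

definition graceful_labeling :: "'a set \<Rightarrow> 'a set set \<Rightarrow> ('a \<Rightarrow> int) \<Rightarrow> bool" where
  "graceful_labeling V E f \<longleftrightarrow>
     inj_on f V \<and> f ` V \<subseteq> {0..int (card E)} \<and>
     {\<bar>f x - f y\<bar> | x y. {x, y} \<in> E} = {1..int (card E)}"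

definition graceful :: "'a set \<Rightarrow> 'a set set \<Rightarrow> bool" where
  "graceful V E \<longleftrightarrow> (\<exists>f. graceful_labeling V E f)"

end

theory Submission
  imports Defs "HOL-Library.Multiset"
begin

text \<open>
  If an \<open>\<alpha>\<close>-labeled spider and a gracefully labeled spider both have their center labeled 0,
  reversing the \<open>\<alpha>\<close>-labeling moves its center next to the gap between its two classes; widening the
  gap and inserting the second spider there glues the two at the center. Legs of length 1 can be
  added freely at a vertex labeled 0, also in the \<open>\<alpha>\<close>-labeled part.

  Two legs \<open>a \<le> b\<close> have an \<open>\<alpha>\<close>-labeling with center 0, unless \<open>a = b\<close> is even or \<open>b = 4 * (a div 2) + 1\<close>
  with \<open>a \<ge> 2\<close>: wrap a zigzag of length \<open>a\<close> around an \<open>\<alpha>\<close>-labeled path on \<open>b\<close> vertices that starts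
  with the label \<open>a div 2\<close>. One leg of arbitrary length, or two equal even legs, together with any
  number of legs of length 2 have a graceful labeling with center 0, by the doubling of Broersma
  and Hoede applied to the spider that arises by contracting a matching. Among three long legs
  there are always either two equal even ones or a pair that is not exceptional.
\<close>

subsection \<open>Labeled paths\<close>

fun path_diffs :: "int list \<Rightarrow> int list" where
  "path_diffs (x # y # xs) = \<bar>x - y\<bar> # path_diffs (y # xs)"
| "path_diffs _ = []"

lemma path_diffs_append:
  "xs \<noteq> [] \<Longrightarrow> ys \<noteq> [] \<Longrightarrow>
    path_diffs (xs @ ys) = path_diffs xs @ \<bar>last xs - hd ys\<bar> # path_diffs ys"
proof (induction xs rule: path_diffs.induct)
  case ("2_2" v)
  then show ?case by (cases ys) auto
qed auto

lemma path_diffs_Cons: "xs \<noteq> [] \<Longrightarrow> path_diffs (x # xs) = \<bar>x - hd xs\<bar> # path_diffs xs"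
  by (cases xs) auto

lemma set_path_diffs_rev: "set (path_diffs (rev xs)) = set (path_diffs xs)"
proof (induction xs rule: path_diffs.induct)
  case (1 x y xs)
  have "path_diffs (rev (x # y # xs)) = path_diffs (rev (y # xs)) @ [\<bar>y - x\<bar>]"
    using path_diffs_append[of "rev (y # xs)" "[x]"] by simp
  then show ?case using 1 by auto
qed auto

lemma path_diffs_reflect: "path_diffs (map (\<lambda>x. c - x) xs) = path_diffs xs"
  by (induction xs rule: path_diffs.induct) auto

lemma path_diffs_translate: "path_diffs (map (\<lambda>x. x + c) xs) = path_diffs xs"
  by (induction xs rule: path_diffs.induct) auto

definition alternating :: "int \<Rightarrow> int list \<Rightarrow> bool" where
  "alternating k = successively (\<lambda>x y. (x \<le> k) \<noteq> (y \<le> k))"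

lemma alternating_simps [simp]:
  "alternating k []" "alternating k [x]"
  "alternating k (x # y # xs) \<longleftrightarrow> (x \<le> k) \<noteq> (y \<le> k) \<and> alternating k (y # xs)"
  by (auto simp: alternating_def)

lemma alternating_Cons:
  "xs \<noteq> [] \<Longrightarrow> alternating k (x # xs) \<longleftrightarrow> (x \<le> k) \<noteq> (hd xs \<le> k) \<and> alternating k xs"
  by (cases xs) auto

lemma alternating_append:
  "xs \<noteq> [] \<Longrightarrow> ys \<noteq> [] \<Longrightarrow> alternating k (xs @ ys) \<longleftrightarrow>
    alternating k xs \<and> (last xs \<le> k) \<noteq> (hd ys \<le> k) \<and> alternating k ys"
  by (auto simp: alternating_def successively_append_iff)

lemma alternating_rev: "alternating k (rev xs) = alternating k xs"
proof -
  have "(\<lambda>x y. (y \<le> k) \<noteq> (x \<le> k)) = (\<lambda>x y. (x \<le> k) \<noteq> (y \<le> k))" by (intro ext) auto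
  then show ?thesis unfolding alternating_def by (simp only: successively_rev)
qed

lemma alternating_map_iff:
  "(\<And>x. x \<in> set xs \<Longrightarrow> (f x \<le> k') = (x \<le> k)) \<Longrightarrow> alternating k' (map f xs) = alternating k xs"
  by (induction xs rule: path_diffs.induct) auto

lemma alternating_map_iff_not:
  "(\<And>x. x \<in> set xs \<Longrightarrow> (f x \<le> k') = (\<not> x \<le> k)) \<Longrightarrow> alternating k' (map f xs) = alternating k xs"
  by (induction xs rule: path_diffs.induct) auto

text \<open>For \<open>c = s + 1\<close> this is the reversal of an \<open>\<alpha>\<close>-labeling with \<open>s\<close> edges;
  a larger \<open>c\<close> opens a gap above \<open>k\<close>.\<close>

definition flip :: "int \<Rightarrow> int \<Rightarrow> int \<Rightarrow> int" where
  "flip k c x = (if x \<le> k then k - x else k + c - x)"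

lemma path_diffs_flip:
  assumes "alternating k xs" and "\<And>d. d \<in> set (path_diffs xs) \<Longrightarrow> d \<le> c"
  shows "path_diffs (map (flip k c) xs) = map (\<lambda>d. c - d) (path_diffs xs)"
  using assms
proof (induction xs rule: path_diffs.induct)
  case (1 x y xs)
  have "\<bar>x - y\<bar> \<le> c" using 1(3)[of "\<bar>x - y\<bar>"] by simp
  moreover have "(x \<le> k) \<noteq> (y \<le> k)" using 1(2) by simp
  ultimately have "\<bar>flip k c x - flip k c y\<bar> = c - \<bar>x - y\<bar>"
    by (auto simp: flip_def split: if_splits)
  then show ?case using 1 by simp
qed auto

definition zz :: "int \<Rightarrow> nat \<Rightarrow> int" where
  "zz n j = (if even j then int (j div 2) else n - int (j div 2))"

definition zigzag :: "int \<Rightarrow> nat \<Rightarrow> int list" where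
  "zigzag n a = map (zz n) [0..<Suc a]"

lemma zigzag_Suc: "zigzag n (Suc a) = zigzag n a @ [zz n (Suc a)]"
  by (simp add: zigzag_def)

lemma zigzag_simps [simp]:
  "zigzag n 0 = [0]" "length (zigzag n a) = Suc a" "zigzag n a \<noteq> []"
  "hd (zigzag n a) = 0" "last (zigzag n a) = zz n a"
  by (auto simp: zigzag_def zz_def hd_map hd_append)

lemma path_diffs_zigzag:
  "int a \<le> n \<Longrightarrow> set (path_diffs (zigzag n a)) = {n - int a + 1..n}"
proof (induction a)
  case (Suc a)
  have "\<bar>zz n a - zz n (Suc a)\<bar> = n - int a"
    using Suc.prems by (auto simp: zz_def elim!: evenE oddE)
  then have "set (path_diffs (zigzag n (Suc a))) = insert (n - int a) {n - int a + 1..n}"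
    using Suc by (simp add: zigzag_Suc path_diffs_append)
  also have "\<dots> = {n - int (Suc a) + 1..n}" using Suc.prems by auto
  finally show ?case .
qed auto

lemma set_zigzag:
  "set (zigzag n a) = {0..int (a div 2)} \<union> {n - int ((a + 1) div 2) + 1..n}"
proof (induction a)
  case (Suc a)
  show ?case
  proof (cases "even a")
    case True
    then obtain c where a: "a = 2 * c" by (elim evenE)
    have "zz n (Suc a) = n - int c" "a div 2 = c" "(a + 1) div 2 = c"
      "Suc a div 2 = c" "(Suc a + 1) div 2 = Suc c"
      unfolding a by (auto simp: zz_def)
    moreover have "insert (n - int c) {n - int c + 1..n} = {n - int (Suc c) + 1..n}"
      by auto
    ultimately show ?thesis using Suc unfolding zigzag_Suc by auto
  next
    case False
    then obtain c where a: "a = 2 * c + 1" by (elim oddE)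
    have "zz n (Suc a) = int (Suc c)" "a div 2 = c" "(a + 1) div 2 = Suc c"
      "Suc a div 2 = Suc c" "(Suc a + 1) div 2 = Suc c"
      unfolding a by (auto simp: zz_def)
    moreover have "insert (int (Suc c)) {0..int c} = {0..int (Suc c)}"
      by auto
    ultimately show ?thesis using Suc unfolding zigzag_Suc by auto
  qed
qed auto

lemma alternating_zigzag:
  assumes "int (a div 2) \<le> k" "k < n - int ((a + 1) div 2) + 1"
  shows "alternating k (zigzag n a)"
  using assms
proof (induction a)
  case (Suc a)
  then have "alternating k (zigzag n a)" by simp
  moreover have "(zz n a \<le> k) \<noteq> (zz n (Suc a) \<le> k)"
    using Suc.prems by (cases "even a") (auto simp: zz_def elim!: evenE oddE)
  ultimately show ?case by (simp add: zigzag_Suc alternating_append)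
qed auto

definition graceful_path :: "int list \<Rightarrow> bool" where
  "graceful_path p \<longleftrightarrow> p \<noteq> [] \<and> set p = {0..int (length p) - 1} \<and>
     set (path_diffs p) = {1..int (length p) - 1}"

lemma graceful_path_reflect:
  assumes "graceful_path p"
  shows "graceful_path (map (\<lambda>x. int (length p) - 1 - x) p)"
proof -
  have "(\<lambda>x. int (length p) - 1 - x) ` {0..int (length p) - 1} = {0..int (length p) - 1}"
    by simp
  then show ?thesis
    using assms by (simp add: graceful_path_def path_diffs_reflect)
qed

lemma graceful_path_zigzag: "graceful_path (zigzag (int a) a)"
proof -
  have "int a = int (a div 2) + int ((a + 1) div 2)"
    by (cases "even a") (auto elim!: evenE oddE)
  then show ?thesis
    by (auto simp: graceful_path_def set_zigzag path_diffs_zigzag)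
qed

lemma wrap_labels:
  assumes "graceful_path p" "length p = b" "a div 2 = t"
  shows "set (zigzag (int (a + b)) a) \<union> set (map (\<lambda>x. int (b + t) - x) p) = {0..int (a + b)}"
proof -
  have "set (map (\<lambda>x. int (b + t) - x) p) = {int t + 1..int (b + t)}"
    using assms by (simp add: graceful_path_def)
  moreover have "int a = int t + int ((a + 1) div 2)"
    using assms(3) by (cases "even a") (auto elim!: evenE oddE)
  ultimately show ?thesis
    by (auto simp: set_zigzag assms(3))
qed

lemma wrap_diffs:
  assumes "graceful_path p" "length p = b" "a div 2 = t" "hd p = int t"
  shows "set (path_diffs (zigzag (int (a + b)) a)) = {int b + 1..int (a + b)}"
    and "hd (map (\<lambda>x. int (b + t) - x) p) = int b"
    and "set (path_diffs (0 # map (\<lambda>x. int (b + t) - x) p)) = {1..int b}"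
proof -
  have ne: "p \<noteq> []" using assms by (simp add: graceful_path_def)
  show "set (path_diffs (zigzag (int (a + b)) a)) = {int b + 1..int (a + b)}"
    by (subst path_diffs_zigzag) auto
  show h: "hd (map (\<lambda>x. int (b + t) - x) p) = int b"
    using ne assms by (simp add: hd_map)
  have "b \<ge> 1" using ne assms(2) by (cases p) auto
  then show "set (path_diffs (0 # map (\<lambda>x. int (b + t) - x) p)) = {1..int b}"
    using assms ne h by (subst path_diffs_Cons) (auto simp: path_diffs_reflect graceful_path_def)
qed

lemma wrap_alternating:
  assumes "graceful_path p" "length p = b" "a div 2 = t" "hd p = int t"
    "t \<le> (b - 1) div 2" "alternating (int ((b - 1) div 2)) p"
  defines "K \<equiv> int (b div 2 + t)"
  shows "alternating K (zigzag (int (a + b)) a)"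
    and "alternating K (0 # map (\<lambda>x. int (b + t) - x) p)"
proof -
  have ne: "p \<noteq> []" using assms by (simp add: graceful_path_def)
  have b1: "b \<ge> 1" using ne assms(2) by (cases p) auto
  have a: "int a = int t + int ((a + 1) div 2)"
    using assms(3) by (cases "even a") (auto elim!: evenE oddE)
  show "alternating K (zigzag (int (a + b)) a)"
    by (rule alternating_zigzag) (use a b1 assms(3) in \<open>auto simp: K_def\<close>)
  have b: "int ((b - 1) div 2) = int b - 1 - int (b div 2)"
    using b1 by (cases "even b") (auto elim!: evenE oddE)
  have "alternating K (map (\<lambda>x. int (b + t) - x) p) = alternating (int ((b - 1) div 2)) p"
    by (rule alternating_map_iff_not) (simp only: K_def b, auto)
  moreover have "int t < int b - int (b div 2)" using assms(5) b by linarith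
  ultimately show "alternating K (0 # map (\<lambda>x. int (b + t) - x) p)"
    using assms(4,6) ne by (subst alternating_Cons) (auto simp: hd_map K_def)
qed

text \<open>An \<open>\<alpha>\<close>-labeled path on \<open>b\<close> vertices with an end vertex labeled \<open>t\<close> in the lower class;
  the lower class has \<open>\<lceil>b/2\<rceil>\<close> vertices, which fixes the threshold.\<close>

definition alpha_path_from :: "nat \<Rightarrow> nat \<Rightarrow> bool" where
  "alpha_path_from b t \<longleftrightarrow> t \<le> (b - 1) div 2 \<and> (\<exists>p. graceful_path p \<and> length p = b \<and>
     hd p = int t \<and> alternating (int ((b - 1) div 2)) p)"

lemma alpha_path_wrap:
  assumes "alpha_path_from b t" "a div 2 = t"
  obtains q where "graceful_path q" "length q = a + b + 1" "hd q = zz (int (a + b)) a"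
    "alternating (int (b div 2 + t)) q"
proof -
  obtain p where p: "graceful_path p" "length p = b" "hd p = int t"
     "alternating (int ((b - 1) div 2)) p" and t: "t \<le> (b - 1) div 2"
    using assms unfolding alpha_path_from_def by blast
  have ne: "p \<noteq> []" using p by (simp add: graceful_path_def)
  define r where "r = map (\<lambda>x. int (b + t) - x) p"
  have r: "r \<noteq> []" "length r = b" using ne p by (auto simp: r_def)
  let ?q = "rev (zigzag (int (a + b)) a) @ r"
  note L = wrap_labels[OF p(1,2) assms(2), folded r_def]
  note D = wrap_diffs[OF p(1,2) assms(2) p(3), folded r_def]
  note A = wrap_alternating[OF p(1,2) assms(2) p(3) t p(4), folded r_def]
  have lst: "last (rev (zigzag (int (a + b)) a)) = 0"
    by (simp add: last_rev)
  have dq: "set (path_diffs ?q) = {1..int (a + b)}"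
    using D r lst by (subst path_diffs_append) (auto simp: set_path_diffs_rev path_diffs_Cons)
  have "graceful_path ?q"
    using L dq r by (auto simp: graceful_path_def)
  moreover have "length ?q = a + b + 1" using r by simp
  moreover have "hd ?q = zz (int (a + b)) a" by (simp add: hd_append hd_rev)
  moreover have "alternating (int (b div 2 + t)) ?q"
    using A r lst by (subst alternating_append) (auto simp: alternating_rev alternating_Cons)
  ultimately show thesis by (rule that)
qed

lemma alpha_path_from_wrap_even:
  assumes "alpha_path_from b t"
  shows "alpha_path_from (b + 2 * t + 1) t"
proof -
  obtain q where q: "graceful_path q" "length q = 2 * t + b + 1"
    "hd q = zz (int (2 * t + b)) (2 * t)" "alternating (int (b div 2 + t)) q"
    using alpha_path_wrap[OF assms, of "2 * t"] by auto
  moreover have "hd q = int t" using q(3) by (simp add: zz_def)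
  moreover have "length q = b + 2 * t + 1" using q(2) by simp
  moreover have "(b + 2 * t + 1 - 1) div 2 = b div 2 + t" by simp
  ultimately show ?thesis
    unfolding alpha_path_from_def by (metis le_add2)
qed

lemma alpha_path_from_wrap_odd:
  assumes "alpha_path_from b t"
  shows "alpha_path_from (b + 2 * t + 2) t"
proof -
  obtain q where q: "graceful_path q" "length q = (2 * t + 1) + b + 1"
    "hd q = zz (int (2 * t + 1 + b)) (2 * t + 1)" "alternating (int (b div 2 + t)) q"
    by (rule alpha_path_wrap[OF assms, of "2 * t + 1"]) simp
  let ?q' = "map (\<lambda>x. int (length q) - 1 - x) q"
  have "hd ?q' = int t"
    using q(1-3) by (subst hd_map) (auto simp: zz_def graceful_path_def)
  moreover have k: "(b + 2 * t + 2 - 1) div 2 = (b + 1) div 2 + t" by simp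
  have "int b = int (b div 2) + int ((b + 1) div 2)"
    by (cases "even b") (auto elim!: evenE oddE)
  then have "alternating (int ((b + 1) div 2 + t)) ?q' = alternating (int (b div 2 + t)) q"
    using q(2) by (intro alternating_map_iff_not) auto
  moreover have "graceful_path ?q'" using graceful_path_reflect[OF q(1)] .
  moreover have "length ?q' = b + 2 * t + 2" using q(2) by simp
  ultimately show ?thesis
    unfolding alpha_path_from_def k using q(4) by (metis le_add2)
qed

lemma alpha_path_from_flip:
  assumes "alpha_path_from b t"
  shows "alpha_path_from b ((b - 1) div 2 - t)"
proof -
  define k where "k = (b - 1) div 2"
  obtain p where p: "graceful_path p" "length p = b" "hd p = int t"
     "alternating (int k) p" and t: "t \<le> k"
    using assms unfolding alpha_path_from_def k_def by blast
  have ne: "p \<noteq> []" using p by (simp add: graceful_path_def)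
  have b1: "b \<ge> 1" using ne p(2) by (cases p) auto
  have kb: "k < b" using b1 by (auto simp: k_def)
  let ?q = "map (flip (int k) (int b)) p"
  have "path_diffs ?q = map (\<lambda>d. int b - d) (path_diffs p)"
    using p by (intro path_diffs_flip) (auto simp: graceful_path_def)
  then have "set (path_diffs ?q) = {1..int b - 1}"
    using p by (simp add: graceful_path_def)
  moreover have "flip (int k) (int b) ` {0..int b - 1} = {0..int b - 1}"
  proof -
    have rng: "flip (int k) (int b) x \<in> {0..int b - 1}" if "x \<in> {0..int b - 1}" for x
      using that kb by (auto simp: flip_def)
    have inv: "flip (int k) (int b) (flip (int k) (int b) x) = x" if "x \<in> {0..int b - 1}" for x
      using that kb by (auto simp: flip_def)
    show ?thesis
    proof (intro equalityI subsetI)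
      fix x assume "x \<in> flip (int k) (int b) ` {0..int b - 1}"
      then show "x \<in> {0..int b - 1}" using rng by blast
    next
      fix x assume "x \<in> {0..int b - 1}"
      then show "x \<in> flip (int k) (int b) ` {0..int b - 1}"
        using rng inv by (metis image_eqI)
    qed
  qed
  ultimately have "graceful_path ?q" using p ne by (auto simp: graceful_path_def)
  moreover have "hd ?q = int (k - t)" using ne p t by (simp add: hd_map flip_def of_nat_diff)
  moreover have "alternating (int k) ?q = alternating (int k) p"
    using p kb by (intro alternating_map_iff) (auto simp: graceful_path_def flip_def)
  ultimately show ?thesis
    unfolding alpha_path_from_def k_def[symmetric] using p by (metis diff_le_self length_map)
qed

lemma alpha_path_from_middle:
  assumes "b \<ge> 1" shows "alpha_path_from b ((b - 1) div 2)"
proof -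
  define a where "a = b - 1"
  have b: "b = Suc a" using assms by (simp add: a_def)
  let ?p = "rev (zigzag (int a) a)"
  have g: "graceful_path ?p"
    using graceful_path_zigzag[of a] by (simp add: graceful_path_def set_path_diffs_rev)
  have a2: "int a = int (a div 2) + int ((a + 1) div 2)"
    by (cases "even a") (auto elim!: evenE oddE)
  have alt: "alternating (int (a div 2)) ?p"
    using a2 by (auto simp: alternating_rev intro!: alternating_zigzag)
  show ?thesis
  proof (cases "even a")
    case True
    then have "hd ?p = int (a div 2)" by (simp add: hd_rev zz_def)
    then show ?thesis unfolding alpha_path_from_def b using g alt by auto
  next
    case False
    let ?q = "map (\<lambda>x. int (length ?p) - 1 - x) ?p"
    have a3: "int a = 2 * int (a div 2) + 1" using False by (auto elim!: oddE)
    have "hd ?q = int (a div 2)"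
      using False a3 by (subst hd_map) (auto simp: hd_rev zz_def)
    moreover have "alternating (int (a div 2)) ?q = alternating (int (a div 2)) ?p"
      using a3 by (intro alternating_map_iff_not) auto
    moreover have "graceful_path ?q" using graceful_path_reflect[OF g] .
    moreover have "length ?q = b" by (simp add: b)
    ultimately show ?thesis unfolding alpha_path_from_def using alt
      by (metis a_def le_refl)
  qed
qed

text \<open>The excluded case \<open>b = 4 * t + 1\<close> is the fixed point of the reversal, where neither reversing nor
  unwrapping makes progress; for \<open>t = 1\<close> the claim is in fact false there.\<close>

lemma alpha_path_from_exists:
  assumes "2 * t + 1 \<le> b" "t = 0 \<or> b \<noteq> 4 * t + 1"
  shows "alpha_path_from b t"
  using assms
proof (induction "b + t" arbitrary: b t rule: less_induct)
  case less
  consider "t = (b - 1) div 2" | "b = 6 * t + 2" "t \<ge> 1" | "b \<ge> 4 * t + 2" "t = 0 \<or> b \<noteq> 6 * t + 2"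
    | "2 * t + 3 \<le> b" "b \<le> 4 * t"
    using less.prems by linarith
  then show ?case
  proof cases
    case 1
    then show ?thesis using alpha_path_from_middle less.prems by simp
  next
    case 2
    then have "alpha_path_from (4 * t) t" by (intro less.hyps) auto
    then have "alpha_path_from (4 * t + 2 * t + 2) t" by (rule alpha_path_from_wrap_odd)
    then show ?thesis using 2 by simp
  next
    case 3
    then have "alpha_path_from (b - (2 * t + 1)) t" by (intro less.hyps) auto
    then have "alpha_path_from (b - (2 * t + 1) + 2 * t + 1) t" by (rule alpha_path_from_wrap_even)
    then show ?thesis using 3 by simp
  next
    case 4
    define s where "s = (b - 1) div 2 - t"
    have "t \<le> (b - 1) div 2" using 4 by linarith
    have "s < t" using 4 by (auto simp: s_def)
    have "2 * (s + t) + 1 \<le> b" using 4 by (auto simp: s_def)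
    then have "4 * s + 3 \<le> b" using \<open>s < t\<close> by presburger
    then have "alpha_path_from b s" using \<open>s < t\<close> by (intro less.hyps) auto
    then have "alpha_path_from b ((b - 1) div 2 - s)" by (rule alpha_path_from_flip)
    then show ?thesis using \<open>t \<le> _\<close> by (simp add: s_def)
  qed
qed

subsection \<open>Labeled spiders\<close>

definition spider_labeling :: "int \<Rightarrow> int list list \<Rightarrow> bool" where
  "spider_labeling z L \<longleftrightarrow> set (z # concat L) = {0..int (length (concat L))} \<and>
     (\<Union>l\<in>set L. set (path_diffs (z # l))) = {1..int (length (concat L))}"

lemma spider_labeling_distinct:
  assumes "spider_labeling z L" shows "distinct (z # concat L)"
proof (rule card_distinct)
  show "card (set (z # concat L)) = length (z # concat L)"
    using assms unfolding spider_labeling_def by (simp del: set_concat)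
qed

lemma spider_labeling_set0:
  assumes "spider_labeling 0 L" shows "set (concat L) = {1..int (length (concat L))}"
proof -
  have "0 \<notin> set (concat L)" using spider_labeling_distinct[OF assms] by simp
  then have "set (concat L) = set (0 # concat L) - {0}" by auto
  also have "\<dots> = {1..int (length (concat L))}"
    using assms unfolding spider_labeling_def by auto
  finally show ?thesis .
qed

lemma spider_labeling_cong_mset:
  assumes "mset L = mset L'" shows "spider_labeling z L = spider_labeling z L'"
proof -
  have "length (concat L) = length (concat L')"
    using assms by (metis length_concat mset_map sum_mset_sum_list)
  moreover have "set L = set L'" using assms by (metis set_mset_mset)
  ultimately show ?thesis by (simp add: spider_labeling_def)
qed

lemma spider_labeling_add_leaf:
  assumes "spider_labeling 0 L"
  shows "spider_labeling 0 ([int (length (concat L)) + 1] # L)"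
proof -
  let ?n = "int (length (concat L))"
  have "set (0 # concat ([?n + 1] # L)) = insert (?n + 1) {0..?n}"
    using assms unfolding spider_labeling_def by auto
  also have "\<dots> = {0..?n + 1}" by auto
  finally have labels: "set (0 # concat ([?n + 1] # L)) = {0..?n + 1}" .
  have "(\<Union>l\<in>set ([?n + 1] # L). set (path_diffs (0 # l))) = insert (?n + 1) {1..?n}"
    using assms unfolding spider_labeling_def by (simp add: add.commute)
  also have "\<dots> = {1..?n + 1}" by auto
  finally have "(\<Union>l\<in>set ([?n + 1] # L). set (path_diffs (0 # l))) = {1..?n + 1}" .
  moreover have "int (length (concat ([?n + 1] # L))) = ?n + 1" by simp
  ultimately show ?thesis using labels unfolding spider_labeling_def by metis
qed

definition alpha_spider :: "int list list \<Rightarrow> bool" where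
  "alpha_spider L \<longleftrightarrow> spider_labeling 0 L \<and>
     (\<exists>k\<ge>0. k \<le> int (length (concat L)) \<and> (\<forall>l\<in>set L. alternating k (0 # l)))"

lemma alpha_spider_add_leaves:
  "alpha_spider L \<Longrightarrow> \<exists>L'. alpha_spider (L' @ L) \<and> map length L' = replicate m 1"
proof (induction m)
  case 0
  then show ?case by (intro exI[of _ "[]"]) simp
next
  case (Suc m)
  then obtain L' where L': "alpha_spider (L' @ L)" "map length L' = replicate m 1" by blast
  let ?L = "[int (length (concat (L' @ L))) + 1] # L' @ L"
  obtain k where "k \<ge> 0" "k \<le> int (length (concat (L' @ L)))"
    "\<forall>l\<in>set (L' @ L). alternating k (0 # l)"
    using L' unfolding alpha_spider_def by blast
  then have "\<forall>l\<in>set ?L. alternating k (0 # l)" "k \<le> int (length (concat ?L))"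
    by auto
  then have "alpha_spider ?L"
    using L' spider_labeling_add_leaf[of "L' @ L"] \<open>k \<ge> 0\<close> unfolding alpha_spider_def by blast
  then show ?case using L'(2)
    by (intro exI[of _ "[int (length (concat (L' @ L))) + 1] # L'"]) simp
qed

text \<open>The reversed \<open>\<alpha>\<close>-labeling moves the center to the threshold \<open>k\<close>, the last label below the
  gap into which the second spider is inserted.\<close>

lemma spider_labeling_graft:
  assumes "alpha_spider L" "spider_labeling 0 M"
  shows "\<exists>z L'. spider_labeling z L' \<and> map length L' = map length (L @ M)"
proof -
  define n where "n = int (length (concat L))"
  define m where "m = int (length (concat M))"
  have nm: "n \<ge> 0" "m \<ge> 0" by (auto simp: n_def m_def)
  obtain k where k: "0 \<le> k" "k \<le> n" "\<And>l. l \<in> set L \<Longrightarrow> alternating k (0 # l)"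
    and L: "spider_labeling 0 L"
    using assms unfolding alpha_spider_def n_def by blast
  define f where "f = flip k (n + m + 1)"
  define g where "g = (\<lambda>x. x + k)"
  let ?L = "map (map f) L @ map (map g) M"
  have f0: "f 0 = k" using k by (simp add: f_def flip_def)
  have g0: "g 0 = k" by (simp add: g_def)
  have len: "map length ?L = map length (L @ M)" by simp
  have lc: "int (length (concat ?L)) = n + m"
    by (simp add: n_def m_def length_concat o_def)
  have "set (k # concat ?L) = f ` set (0 # concat L) \<union> g ` set (0 # concat M)"
    using f0 g0 by (auto simp: image_UN)
  also have "\<dots> = f ` {0..n} \<union> g ` {0..m}"
    using L assms(2) unfolding spider_labeling_def n_def m_def by simp
  also have "g ` {0..m} = {k..k + m}"
    by (simp add: g_def add.commute)
  also have "f ` {0..n} = (\<lambda>x. k - x) ` {0..k} \<union> (\<lambda>x. (k + (n + m + 1)) - x) ` {k + 1..n}"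
  proof -
    have "{0..n} = {0..k} \<union> {k + 1..n}" using k by auto
    moreover have "f ` {0..k} = (\<lambda>x. k - x) ` {0..k}"
      by (intro image_cong) (auto simp: f_def flip_def)
    moreover have "f ` {k + 1..n} = (\<lambda>x. (k + (n + m + 1)) - x) ` {k + 1..n}"
      by (intro image_cong) (auto simp: f_def flip_def)
    ultimately show ?thesis by (simp only: image_Un)
  qed
  also have "\<dots> = {0..k} \<union> {k + m + 1..n + m}" by (simp add: algebra_simps)
  also have "({0..k} \<union> {k + m + 1..n + m}) \<union> {k..k + m} = {0..n + m}" using k nm by auto
  finally have labels: "set (k # concat ?L) = {0..int (length (concat ?L))}"
    unfolding lc .
  have "set (path_diffs (k # map f l)) = (\<lambda>d. (n + m + 1) - d) ` set (path_diffs (0 # l))"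
    if "l \<in> set L" for l
  proof -
    have "set (path_diffs (0 # l)) \<subseteq> {1..n}"
      using L that unfolding spider_labeling_def n_def by blast
    then have "path_diffs (map f (0 # l)) = map (\<lambda>d. (n + m + 1) - d) (path_diffs (0 # l))"
      unfolding f_def using k(3)[OF that] nm by (intro path_diffs_flip) auto
    then show ?thesis by (simp add: f0)
  qed
  then have "(\<Union>l\<in>set L. set (path_diffs (k # map f l))) =
      (\<lambda>d. (n + m + 1) - d) ` (\<Union>l\<in>set L. set (path_diffs (0 # l)))"
    by (simp add: image_UN)
  also have "\<dots> = (\<lambda>d. (n + m + 1) - d) ` {1..n}"
    using L unfolding spider_labeling_def n_def by simp
  also have "\<dots> = {m + 1..n + m}" by (simp add: algebra_simps)
  finally have d1: "(\<Union>l\<in>set L. set (path_diffs (k # map f l))) = {m + 1..n + m}" .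
  have "path_diffs (k # map g l) = path_diffs (0 # l)" for l
    using path_diffs_translate[of k "0 # l"] by (simp add: g_def)
  then have d2: "(\<Union>l\<in>set M. set (path_diffs (k # map g l))) = {1..m}"
    using assms(2) unfolding spider_labeling_def m_def by simp
  have "(\<Union>l\<in>set ?L. set (path_diffs (k # l))) =
      (\<Union>l\<in>set L. set (path_diffs (k # map f l))) \<union> (\<Union>l\<in>set M. set (path_diffs (k # map g l)))"
    by simp
  also have "\<dots> = {1..n + m}" unfolding d1 d2 using nm by auto
  finally have "spider_labeling k ?L"
    using labels unfolding spider_labeling_def lc by blast
  then show ?thesis using len by blast
qed

lemma zigzag_leg:
  obtains l where "zigzag n a = 0 # l" "length l = a"
  by (cases "zigzag n a") (use zigzag_simps(2,4)[of n a] in auto)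

lemma alpha_spider_single: "\<exists>l. length l = a \<and> alpha_spider [l]"
proof -
  obtain l where l: "zigzag (int a) a = 0 # l" "length l = a" by (rule zigzag_leg)
  have a: "int a = int (a div 2) + int ((a + 1) div 2)"
    by (cases "even a") (auto elim!: evenE oddE)
  have "alternating (int (a div 2)) (zigzag (int a) a)"
    using a by (intro alternating_zigzag) auto
  moreover have "spider_labeling 0 [l]"
    using graceful_path_zigzag[of a] l by (simp add: graceful_path_def spider_labeling_def)
  ultimately have "alpha_spider [l]"
    unfolding alpha_spider_def using l by (auto intro!: exI[of _ "int (a div 2)"])
  then show ?thesis using l by blast
qed

lemma spider_labeling_wrap:
  assumes "graceful_path p" "length p = b" "a div 2 = t" "hd p = int t"
    and "zigzag (int (a + b)) a = 0 # l" "length l = a"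
  shows "spider_labeling 0 [l, map (\<lambda>x. int (b + t) - x) p]"
proof -
  let ?r = "map (\<lambda>x. int (b + t) - x) p"
  have "set (0 # concat [l, ?r]) = {0..int (a + b)}"
    using wrap_labels[OF assms(1-3)] unfolding assms(5) by simp
  moreover have "(\<Union>m\<in>set [l, ?r]. set (path_diffs (0 # m))) = {1..int (a + b)}"
    using wrap_diffs(1,3)[OF assms(1-4)] unfolding assms(5) by auto
  moreover have "length (concat [l, ?r]) = a + b" using assms by simp
  ultimately show ?thesis unfolding spider_labeling_def by metis
qed

lemma alpha_spider_pair:
  assumes "2 * (a div 2) + 1 \<le> b" "a div 2 = 0 \<or> b \<noteq> 4 * (a div 2) + 1"
  shows "\<exists>l r. length l = a \<and> length r = b \<and> alpha_spider [l, r]"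
proof -
  define t where "t = a div 2"
  obtain p where p: "graceful_path p" "length p = b" "hd p = int t"
     "alternating (int ((b - 1) div 2)) p" and t: "t \<le> (b - 1) div 2"
    using alpha_path_from_exists[OF assms] unfolding alpha_path_from_def t_def by blast
  obtain l where l: "zigzag (int (a + b)) a = 0 # l" "length l = a" by (rule zigzag_leg)
  let ?r = "map (\<lambda>x. int (b + t) - x) p"
  have "spider_labeling 0 [l, ?r]"
    by (rule spider_labeling_wrap[OF p(1,2) t_def[symmetric] p(3) l])
  moreover have "alternating (int (b div 2 + t)) (0 # l)" "alternating (int (b div 2 + t)) (0 # ?r)"
    using wrap_alternating[OF p(1,2) t_def[symmetric] p(3) t p(4)] unfolding l by blast+
  moreover have "b div 2 + t \<le> length (concat [l, ?r])" using l p by (simp add: t_def)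
  ultimately have "alpha_spider [l, ?r]"
    unfolding alpha_spider_def by (intro conjI exI[of _ "int (b div 2 + t)"]) auto
  then show ?thesis using l p by (intro exI[of _ l] exI[of _ ?r]) simp
qed

lemma spider_labeling_equal_pair:
  assumes "q \<ge> 1"
  shows "\<exists>l r. length l = q \<and> length r = q \<and> spider_labeling 0 [l, r]"
proof -
  define t where "t = q div 2"
  define p where "p = rev (zigzag (int (q - 1)) (q - 1))"
  have p: "graceful_path p" "length p = q"
    using graceful_path_zigzag[of "q - 1"] assms
    by (auto simp: graceful_path_def set_path_diffs_rev p_def)
  have "hd p = int t"
    using assms by (cases "even q") (auto simp: p_def hd_rev zz_def t_def elim!: evenE oddE)
  moreover obtain l where l: "zigzag (int (q + q)) q = 0 # l" "length l = q" by (rule zigzag_leg)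
  ultimately have "spider_labeling 0 [l, map (\<lambda>x. int (q + t) - x) p]"
    by (intro spider_labeling_wrap) (auto simp: t_def p)
  then show ?thesis using l p
    by (intro exI[of _ l] exI[of _ "map (\<lambda>x. int (q + t) - x) p"]) simp
qed

text \<open>The strongly graceful labeling of Broersma and Hoede: a vertex labeled \<open>g\<close> is replaced by a
  matching edge with labels \<open>2g\<close> and \<open>N - 2g\<close>, where \<open>N\<close> is the new number of edges. An old edge
  always joins two labels of the same parity, so its difference doubles, while the matching
  edges contribute the odd differences.\<close>

fun dbl :: "int \<Rightarrow> int list \<Rightarrow> int list" where
  "dbl N [] = []"
| "dbl N (g # gs) = 2 * g # (N - 2 * g) # map (\<lambda>x. N - x) (dbl N gs)"

lemma length_dbl [simp]: "length (dbl N gs) = 2 * length gs"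
  by (induction gs) auto

lemma set_dbl: "set (dbl N gs) = (\<lambda>g. 2 * g) ` set gs \<union> (\<lambda>g. N - 2 * g) ` set gs"
  by (induction gs) (auto simp: image_Un image_image)

lemma path_diffs_dbl:
  "set (path_diffs (2 * h # dbl N gs)) =
    (\<lambda>d. 2 * d) ` set (path_diffs (h # gs)) \<union> (\<lambda>g. \<bar>N - 4 * g\<bar>) ` set gs"
proof (induction gs arbitrary: h)
  case (Cons g gs)
  have "path_diffs ((N - 2 * g) # map (\<lambda>x. N - x) (dbl N gs)) = path_diffs (2 * g # dbl N gs)"
    using path_diffs_reflect[of N "2 * g # dbl N gs"] by simp
  then have "set (path_diffs (2 * h # dbl N (g # gs))) =
     {\<bar>2 * h - 2 * g\<bar>, \<bar>2 * g - (N - 2 * g)\<bar>} \<union> set (path_diffs (2 * g # dbl N gs))"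
    by auto
  moreover have "\<bar>2 * g - (N - 2 * g)\<bar> = \<bar>N - 4 * g\<bar>" "\<bar>2 * h - 2 * g\<bar> = 2 * \<bar>h - g\<bar>"
    by presburger+
  ultimately show ?case using Cons.IH[of g] by auto
qed auto

lemma spider_labeling_dbl:
  assumes "spider_labeling 0 M"
  defines "N \<equiv> 2 * int (length (concat M)) + 1"
  shows "spider_labeling 0 (map (dbl N) M)"
proof -
  define n where "n = int (length (concat M))"
  have n: "n \<ge> 0" and N: "N = 2 * n + 1" by (auto simp: n_def N_def)
  have lc: "int (length (concat (map (dbl N) M))) = 2 * n"
    by (simp add: n_def length_concat o_def sum_list_const_mult)
  have "set (concat (map (dbl N) M)) = (\<lambda>g. 2 * g) ` set (concat M) \<union> (\<lambda>g. N - 2 * g) ` set (concat M)"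
    by (auto simp: set_dbl)
  also have "\<dots> = (\<lambda>g. 2 * g) ` {1..n} \<union> (\<lambda>g. N - 2 * g) ` {1..n}"
    unfolding spider_labeling_set0[OF assms(1), folded n_def] ..
  also have "\<dots> = {1..2 * n}"
  proof (intro equalityI subsetI)
    fix x assume x: "x \<in> {1..2 * n}"
    show "x \<in> (\<lambda>g. 2 * g) ` {1..n} \<union> (\<lambda>g. N - 2 * g) ` {1..n}"
    proof (cases "even x")
      case True
      then obtain y where "x = 2 * y" by (elim evenE)
      then show ?thesis using x by auto
    next
      case False
      then obtain y where "x = 2 * y + 1" by (elim oddE)
      then have "x = N - 2 * (n - y)" "n - y \<in> {1..n}" using x by (auto simp: N)
      then show ?thesis by blast
    qed
  qed (auto simp: N)
  finally have labels: "set (0 # concat (map (dbl N) M)) = {0..2 * n}"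
    using n by (auto simp del: set_concat)
  have "(\<Union>l\<in>set (map (dbl N) M). set (path_diffs (0 # l))) =
      (\<Union>l\<in>set M. (\<lambda>d. 2 * d) ` set (path_diffs (0 # l)) \<union> (\<lambda>g. \<bar>N - 4 * g\<bar>) ` set l)"
    using path_diffs_dbl[of 0 N] by simp
  also have "\<dots> = (\<lambda>d. 2 * d) ` (\<Union>l\<in>set M. set (path_diffs (0 # l))) \<union>
      (\<lambda>g. \<bar>N - 4 * g\<bar>) ` set (concat M)"
    by auto
  also have "\<dots> = (\<lambda>d. 2 * d) ` {1..n} \<union> (\<lambda>g. \<bar>N - 4 * g\<bar>) ` {1..n}"
    using assms(1) spider_labeling_set0[OF assms(1)]
    unfolding spider_labeling_def n_def by metis
  also have "\<dots> = {1..2 * n}"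
  proof (intro equalityI subsetI)
    fix x assume x: "x \<in> {1..2 * n}"
    show "x \<in> (\<lambda>d. 2 * d) ` {1..n} \<union> (\<lambda>g. \<bar>N - 4 * g\<bar>) ` {1..n}"
    proof (cases "even x")
      case True
      then obtain y where "x = 2 * y" by (elim evenE)
      then show ?thesis using x by auto
    next
      case False
      then obtain y where y: "x = 2 * y + 1" by (elim oddE)
      show ?thesis
      proof (cases "even (n - y)")
        case True
        then obtain g where "n - y = 2 * g" by (elim evenE)
        then have "x = \<bar>N - 4 * g\<bar>" "g \<in> {1..n}" using x y by (auto simp: N)
        then show ?thesis by blast
      next
        case False
        then obtain g where "n - y = 2 * g + 1" by (elim oddE)
        then have "x = \<bar>N - 4 * (n - g)\<bar>" "n - g \<in> {1..n}" using x y by (auto simp: N)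
        then show ?thesis by blast
      qed
    qed
  next
    fix x assume "x \<in> (\<lambda>d. 2 * d) ` {1..n} \<union> (\<lambda>g. \<bar>N - 4 * g\<bar>) ` {1..n}"
    then show "x \<in> {1..2 * n}" 
    proof
      assume "x \<in> (\<lambda>g. \<bar>N - 4 * g\<bar>) ` {1..n}"
      then obtain g where g: "x = \<bar>2 * n + 1 - 4 * g\<bar>" "1 \<le> g" "g \<le> n" by (auto simp: N)
      moreover have "2 * n + 1 - 4 * g \<noteq> 0" by presburger
      ultimately show ?thesis by auto
    qed auto
  qed
  finally show ?thesis
    using labels unfolding spider_labeling_def lc by blast
qed

lemma spider_labeling_dbl_odd:
  assumes "spider_labeling 0 (l # M)"
  shows "\<exists>l' M'. length l' = 2 * length l + 1 \<and> map length M' = map (\<lambda>l. 2 * length l) M \<and>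
    spider_labeling 0 (l' # M')"
proof -
  define N where "N = 2 * int (length (concat (l # M))) + 1"
  define M' where "M' = map (dbl N) M"
  define l' where "l' = N # map (\<lambda>x. N - x) (dbl N l)"
  have *: "spider_labeling 0 (dbl N l # M')"
    using spider_labeling_dbl[OF assms] by (simp add: M'_def N_def)
  have len: "int (length (concat (dbl N l # M'))) = N - 1"
    by (simp add: M'_def N_def length_concat o_def sum_list_const_mult)
  then have len': "int (length (concat (l' # M'))) = N"
    by (simp add: l'_def)
  have N1: "N \<ge> 1" by (simp add: N_def)
  have "set (0 # concat (l' # M')) = insert N (set (0 # concat (dbl N l # M')))"
  proof -
    have "set (map (\<lambda>x. N - x) (dbl N l)) = set (dbl N l)"
      by (simp add: set_dbl image_Un image_image Un_commute)
    then show ?thesis by (simp add: l'_def insert_commute del: set_map)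
  qed
  also have "\<dots> = insert N {0..N - 1}"
    using * len unfolding spider_labeling_def by metis
  also have "\<dots> = {0..N}" using N1 by auto
  finally have labels: "set (0 # concat (l' # M')) = {0..N}" .
  have "set (path_diffs (0 # l')) = insert N (set (path_diffs (0 # dbl N l)))"
    using path_diffs_reflect[of N "0 # dbl N l"] N1 by (simp add: l'_def)
  then have "(\<Union>l\<in>set (l' # M'). set (path_diffs (0 # l))) =
      insert N (\<Union>l\<in>set (dbl N l # M'). set (path_diffs (0 # l)))" by simp
  also have "\<dots> = insert N {1..N - 1}"
    using * len unfolding spider_labeling_def by metis
  also have "\<dots> = {1..N}" using N1 by auto
  finally have "spider_labeling 0 (l' # M')"
    using labels len' unfolding spider_labeling_def by metis
  then show ?thesis by (intro exI[of _ l'] exI[of _ M']) (simp add: l'_def M'_def)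
qed

lemma spider_labeling_add_leaves:
  "spider_labeling 0 L \<Longrightarrow> \<exists>L'. spider_labeling 0 (L @ L') \<and> map length L' = replicate m 1"
proof (induction m)
  case 0
  then show ?case by (intro exI[of _ "[]"]) simp
next
  case (Suc m)
  then obtain L' where L': "spider_labeling 0 (L @ L')" "map length L' = replicate m 1" by blast
  let ?l = "[int (length (concat (L @ L'))) + 1]"
  have "spider_labeling 0 (?l # L @ L')" using L' by (intro spider_labeling_add_leaf)
  moreover have "mset (?l # L @ L') = mset (L @ ?l # L')" by simp
  ultimately have "spider_labeling 0 (L @ ?l # L')" using spider_labeling_cong_mset by blast
  then show ?case using L'(2) by (intro exI[of _ "?l # L'"]) simp
qed

lemma spider_labeling_leg_and_twos:
  "\<exists>M. spider_labeling 0 M \<and> map length M = c # replicate m 2"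
proof -
  obtain l where l: "length l = c div 2" "alpha_spider [l]" using alpha_spider_single by blast
  then obtain L' where L': "spider_labeling 0 ([l] @ L')" "map length L' = replicate m 1"
    using spider_labeling_add_leaves[of "[l]" m] unfolding alpha_spider_def by blast
  have twos: "map (\<lambda>l. 2 * length l) L' = replicate m 2"
    using arg_cong[OF L'(2), of "map (\<lambda>x. 2 * x)"] by (simp add: o_def)
  show ?thesis
  proof (cases "even c")
    case True
    then show ?thesis
      using l(1) twos spider_labeling_dbl[OF L'(1)]
      by (intro exI[of _ "map (dbl (2 * int (length (concat ([l] @ L'))) + 1)) ([l] @ L')"])
        (simp add: o_def)
  next
    case False
    then have "2 * (c div 2) + 1 = c" by simp
    then show ?thesis
      
      using spider_labeling_dbl_odd[of l L'] L'(1) l(1) twos by (metis append_Cons append_Nil list.map(2))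
  qed
qed

lemma spider_labeling_equal_even_legs_and_twos:
  assumes "q \<ge> 1"
  shows "\<exists>M. spider_labeling 0 M \<and> map length M = 2 * q # 2 * q # replicate m 2"
proof -
  obtain l r where lr: "length l = q" "length r = q" "spider_labeling 0 [l, r]"
    using spider_labeling_equal_pair[OF assms] by blast
  then obtain L' where L': "spider_labeling 0 ([l, r] @ L')" "map length L' = replicate m 1"
    using spider_labeling_add_leaves by blast
  have twos: "map (\<lambda>l. 2 * length l) L' = replicate m 2"
    using arg_cong[OF L'(2), of "map (\<lambda>x. 2 * x)"] by (simp add: o_def)
  show ?thesis
    using lr(1,2) twos spider_labeling_dbl[OF L'(1)]
    by (intro exI[of _ "map (dbl (2 * int (length (concat ([l, r] @ L'))) + 1)) ([l, r] @ L')"])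
      (simp add: o_def)
qed

definition labelable :: "nat multiset \<Rightarrow> bool" where
  "labelable A \<longleftrightarrow> (\<exists>z L. mset (map length L) = A \<and> spider_labeling z L)"

lemma labelable_graft:
  assumes "alpha_spider L" "spider_labeling 0 M"
  shows "labelable (mset (map length L) + mset (map length M))"
  using spider_labeling_graft[OF assms] unfolding labelable_def by (metis map_append mset_append)

lemma labelable_pair:
  assumes "2 * (a div 2) + 1 \<le> b" "a div 2 = 0 \<or> b \<noteq> 4 * (a div 2) + 1"
  shows "labelable ({#a, b, c#} + replicate_mset l 1 + replicate_mset m 2)"
proof -
  obtain p q where pq: "length p = a" "length q = b" "alpha_spider [p, q]"
    using alpha_spider_pair[OF assms] by blast
  obtain L' where L': "alpha_spider (L' @ [p, q])" "map length L' = replicate l 1"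
    using alpha_spider_add_leaves[OF pq(3)] by blast
  obtain M where M: "spider_labeling 0 M" "map length M = c # replicate m 2"
    using spider_labeling_leg_and_twos[of c m] by (elim exE conjE)
  show ?thesis
    using labelable_graft[OF L'(1) M(1)] L'(2) M(2) pq by (simp add: ac_simps add_mset_commute)
qed

lemma labelable_equal_even:
  assumes "even a" "a \<ge> 1"
  shows "labelable ({#a, a, c#} + replicate_mset l 1 + replicate_mset m 2)"
proof -
  obtain p where p: "length p = c" "alpha_spider [p]"
    using alpha_spider_single by blast
  obtain L' where L': "alpha_spider (L' @ [p])" "map length L' = replicate l 1"
    using alpha_spider_add_leaves[OF p(2)] by blast
  obtain M where M: "spider_labeling 0 M" "map length M = a # a # replicate m 2"
  proof -
    have "2 * (a div 2) = a" "a div 2 \<ge> 1" using assms by (auto elim!: evenE)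
    then show thesis
      using spider_labeling_equal_even_legs_and_twos[of "a div 2" m] that by metis
  qed
  show ?thesis
    using labelable_graft[OF L'(1) M(1)] L'(2) M(2) p by (simp add: ac_simps add_mset_commute)
qed

lemma labelable_sorted:
  assumes "1 \<le> a" "a \<le> b" "b \<le> c"
  shows "labelable ({#a, b, c#} + replicate_mset l 1 + replicate_mset m 2)"
proof -
  consider "even a" "b = a" | "even b" "c = b"
    | "2 * (a div 2) + 1 \<le> b" "a div 2 = 0 \<or> b \<noteq> 4 * (a div 2) + 1"
    | "2 * (a div 2) + 1 \<le> c" "a div 2 = 0 \<or> c \<noteq> 4 * (a div 2) + 1"
    | "odd b" "c = b"
  proof (cases "a = b")
    case True
    show thesis
    proof (cases "even a")
      case True
      then show thesis using that(1) \<open>a = b\<close> by blast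
    next
      case False
      then obtain t where "a = 2 * t + 1" by (elim oddE)
      then show thesis using that(3) \<open>a = b\<close> by auto
    qed
  next
    case False
    have "2 * (a div 2) \<le> a" by simp
    then have b: "2 * (a div 2) + 1 \<le> b" and c: "2 * (a div 2) + 1 \<le> c"
      using False assms by linarith+
    show thesis
    proof (cases "b = c")
      case True
      then show thesis using that(2,5) by blast
    next
      case False
      then show thesis using that(3)[OF b] that(4)[OF c] by linarith
    qed
  qed
  then show ?thesis
  proof cases
    case 1
    then show ?thesis using labelable_equal_even[of a c] assms by simp
  next
    case 2
    then show ?thesis using labelable_equal_even[of b a l m] assms by (simp add: add_mset_commute)
  next
    case 3
    then show ?thesis by (rule labelable_pair)
  next
    case 4
    then show ?thesis using labelable_pair[of a c b l m] by (simp add: add_mset_commute)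
  next
    case 5
    have "2 * (b div 2) + 1 \<le> c" "b div 2 = 0 \<or> c \<noteq> 4 * (b div 2) + 1"
      using 5 by (auto elim!: oddE)
    then show ?thesis using labelable_pair[of b c a l m] by (simp add: add_mset_commute)
  qed
qed

lemma labelable_three:
  assumes "a \<ge> 1" "b \<ge> 1" "c \<ge> 1"
  shows "labelable ({#a, b, c#} + replicate_mset l 1 + replicate_mset m 2)"
proof -
  consider "a \<le> b" "b \<le> c" | "a \<le> c" "c \<le> b" | "b \<le> a" "a \<le> c" | "b \<le> c" "c \<le> a"
    | "c \<le> a" "a \<le> b" | "c \<le> b" "b \<le> a" by linarith
  then show ?thesis
  proof cases
    case 1
    then show ?thesis using labelable_sorted assms by blast
  next
    case 2
    then show ?thesis using labelable_sorted[of a c b l m] assms by (simp add: add_mset_commute)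
  next
    case 3
    then show ?thesis using labelable_sorted[of b a c l m] assms by (simp add: add_mset_commute)
  next
    case 4
    then show ?thesis using labelable_sorted[of b c a l m] assms by (simp add: add_mset_commute)
  next
    case 5
    then show ?thesis using labelable_sorted[of c a b l m] assms by (simp add: add_mset_commute)
  next
    case 6
    then show ?thesis using labelable_sorted[of c b a l m] assms by (simp add: add_mset_commute)
  qed
qed

subsection \<open>The legs of a spider\<close>

lemma graph_path_append_iff:
  assumes "xs \<noteq> []" "ys \<noteq> []"
  shows "graph_path V E (xs @ ys) \<longleftrightarrow> graph_path V E xs \<and> graph_path V E ys \<and>
    set xs \<inter> set ys = {} \<and> {last xs, hd ys} \<in> E"
  using assms by (auto simp: graph_path_def successively_append_iff)

lemma graph_path_rev: "graph_path V E (rev xs) = graph_path V E xs"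
  by (simp add: graph_path_def insert_commute)

lemma graph_path_singleton [simp]: "graph_path V E [x] \<longleftrightarrow> x \<in> V"
  by (simp add: graph_path_def)

lemma graph_path_Cons_Cons:
  "graph_path V E (x # y # xs) \<longleftrightarrow>
    x \<in> V \<and> x \<notin> set (y # xs) \<and> {x, y} \<in> E \<and> graph_path V E (y # xs)"
  by (auto simp: graph_path_def)

fun path_edges :: "'a list \<Rightarrow> 'a set list" where
  "path_edges (x # y # xs) = {x, y} # path_edges (y # xs)"
| "path_edges _ = []"

lemma length_path_edges: "length (path_edges p) = length (tl p)"
  by (induction p rule: path_edges.induct) auto

lemma path_edges_append: "{x, y} \<in> set (path_edges (xs @ x # y # ys))"
proof (induction xs)
  case (Cons a xs)
  then show ?case by (cases xs) auto
qed simp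

lemma path_edges_subset: "graph_path V E p \<Longrightarrow> set (path_edges p) \<subseteq> E"
  by (induction p rule: path_edges.induct) (auto simp: graph_path_Cons_Cons)

locale centered_spider =
  fixes V :: "'a set" and E :: "'a set set" and c :: 'a
  assumes spider: "spider V E" and center: "spider_center V E c"
begin

lemma tree: "tree_graph V E" and fin_V: "finite V"
  and edgeD: "\<And>e. e \<in> E \<Longrightarrow> e \<subseteq> V \<and> card e = 2"
  using spider by (auto simp: spider_def tree_graph_def simple_graph_def)

lemma fin_E: "finite E"
  by (rule finite_subset[of _ "Pow V"]) (use edgeD fin_V in auto)

lemma c_V: "c \<in> V" and deg_c: "vert_degree E c > 2"
  using center by (auto simp: spider_center_def)

lemma center_unique:
  assumes "spider_center V E v" shows "v = c"
proof -
  have "{v, c} \<subseteq> {v \<in> V. vert_degree E v > 2}"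
    using assms center by (auto simp: spider_center_def)
  then have "card {v, c} \<le> card {v \<in> V. vert_degree E v > 2}"
    by (rule card_mono[rotated]) (use fin_V in simp)
  also have "\<dots> \<le> 1" using spider by (simp add: spider_def)
  finally show ?thesis by (cases "v = c") auto
qed

lemma card_incident_le:
  assumes "A \<subseteq> E" "\<And>e. e \<in> A \<Longrightarrow> v \<in> e" shows "card A \<le> vert_degree E v"
  unfolding vert_degree_def by (rule card_mono) (use fin_E assms in auto)

lemma edge_other_end:
  assumes "e \<in> E" "v \<in> e"
  obtains u where "e = {v, u}" "u \<noteq> v" "u \<in> V"
proof -
  obtain x y where "e = {x, y}" "x \<noteq> y"
    using edgeD[OF assms(1)] by (auto simp: card_2_iff)
  then show thesis using that edgeD[OF assms(1)] assms(2) by auto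
qed

lemma path_chord:
  assumes "graph_path V E (xs @ w # ys)" "ys \<noteq> []" "{last ys, w} \<in> E"
  shows "length ys = 1"
proof (rule ccontr)
  assume "length ys \<noteq> 1"
  then have "length (w # ys) \<ge> 3" using assms(2) by (cases ys) (auto simp: Suc_le_eq)
  moreover have "graph_path V E (w # ys)"
    using assms(1) by (cases "xs = []") (auto simp: graph_path_append_iff)
  ultimately have "graph_cycle V E (w # ys)"
    using assms by (simp add: graph_cycle_def)
  then show False using tree by (auto simp: tree_graph_def)
qed

lemma path_extend:
  assumes "graph_path V E p" "hd p = c" "\<not> leaf V E (last p)"
  obtains u where "graph_path V E (p @ [u])"
proof -
  define w where "w = last p"
  have ne: "p \<noteq> []" using assms by (simp add: graph_path_def)
  have wV: "w \<in> V" using assms ne by (auto simp: graph_path_def w_def)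
  obtain e where e: "e \<in> E" "w \<in> e" "\<And>xs x. p = xs @ [x, w] \<Longrightarrow> e \<noteq> {x, w}"
  proof (cases "\<exists>xs x. p = xs @ [x, w]")
    case False
    have "p = butlast p @ [w]" using ne by (simp add: w_def)
    with False have "butlast p = []"
      by (metis append.assoc append_Cons append_Nil append_butlast_last_id)
    then have "w = c" using assms(2) \<open>p = _\<close> by (metis append_Nil list.sel(1))
    then have "card {e \<in> E. w \<in> e} \<noteq> 0" using deg_c by (simp add: vert_degree_def)
    then show thesis using that False by (auto simp: card_eq_0_iff)
  next
    case True
    then obtain xs x where p: "p = xs @ [x, w]" by blast
    have xw: "{x, w} \<in> E"
      using assms(1) unfolding p by (cases "xs = []") (auto simp: graph_path_append_iff graph_path_Cons_Cons)
    have deg: "vert_degree E w \<noteq> 1" using assms(3) wV by (simp add: leaf_def w_def)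
    have "{e \<in> E. w \<in> e} \<noteq> {{x, w}}"
    proof
      assume "{e \<in> E. w \<in> e} = {{x, w}}"
      then have "vert_degree E w = 1" unfolding vert_degree_def by simp
      then show False using deg by simp
    qed
    then obtain e where "e \<in> E" "w \<in> e" "e \<noteq> {x, w}" using xw by blast
    then show thesis using that p by auto
  qed
  then obtain u where u: "e = {w, u}" "u \<noteq> w" "u \<in> V" using edge_other_end by blast
  have "u \<notin> set p"
  proof
    assume "u \<in> set p"
    then obtain xs ys where p: "p = xs @ u # ys" by (meson split_list)
    have ys: "ys \<noteq> []" "last ys = w"
      using u(2) p by (auto simp: w_def split: if_splits)
    then have "length ys = 1" using path_chord[of xs u ys] assms(1) p e(1) u(1) by simp
    then have "ys = [w]" using ys by (cases ys) auto
    then show False using e(3)[of xs u] p u by auto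
  qed
  then have "graph_path V E (p @ [u])"
    using assms(1) ne u e(1) by (simp add: graph_path_append_iff w_def)
  then show thesis by (rule that)
qed

lemma path_extends_to_leg:
  assumes "graph_path V E p" "hd p = c"
  shows "\<exists>q. p @ q \<in> legs V E"
  using assms
proof (induction "card V - length p" arbitrary: p rule: less_induct)
  case less
  show ?case
  proof (cases "leaf V E (last p)")
    case True
    then have "p @ [] \<in> legs V E" using less.prems center by (simp add: legs_def)
    then show ?thesis by blast
  next
    case False
    then obtain u where u: "graph_path V E (p @ [u])" using path_extend less.prems by blast
    then have "distinct (p @ [u])" "set (p @ [u]) \<subseteq> V" by (auto simp: graph_path_def)
    then have "length (p @ [u]) \<le> card V"
      by (metis card_mono distinct_card fin_V)
    then have "card V - length (p @ [u]) < card V - length p" by simp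
    moreover have "hd (p @ [u]) = c" using less.prems by (auto simp: graph_path_def)
    ultimately show ?thesis using less.hyps u by (metis append.assoc)
  qed
qed

lemma path_from_center:
  assumes "v \<in> V"
  obtains p where "graph_path V E p" "hd p = c" "last p = v"
  using tree assms c_V unfolding tree_graph_def connected_graph_def by blast

lemma edges_of_legs: "E = (\<Union>p\<in>legs V E. set (path_edges p))"
proof (intro equalityI subsetI)
  fix e assume e: "e \<in> E"
  then obtain u where "u \<in> e" using edgeD by fastforce
  then obtain w where w: "e = {u, w}" "w \<noteq> u" "w \<in> V" using edge_other_end e by blast
  have "u \<in> V" using edgeD e \<open>u \<in> e\<close> by blast
  then obtain p where p: "graph_path V E p" "hd p = c" "last p = u" by (rule path_from_center)
  have ne: "p \<noteq> []" using p by (simp add: graph_path_def)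
  show "e \<in> (\<Union>p\<in>legs V E. set (path_edges p))"
  proof (cases "w \<in> set p")
    case True
    then obtain xs ys where xy: "p = xs @ w # ys" by (meson split_list)
    have ys: "ys \<noteq> []" "last ys = u" using w(2) p xy by (auto split: if_splits)
    then have "length ys = 1" using path_chord[of xs w ys] p xy e w(1) by simp
    then have "ys = [u]" using ys by (cases ys) auto
    moreover obtain q where "p @ q \<in> legs V E" using path_extends_to_leg p by blast
    ultimately have "xs @ w # u # q \<in> legs V E" using xy by simp
    then show ?thesis using path_edges_append[of w u xs q] w(1) by (auto simp: insert_commute)
  next
    case False
    then have "graph_path V E (p @ [w])" "hd (p @ [w]) = c"
      using p ne w e by (auto simp: graph_path_append_iff)
    then obtain q where "(p @ [w]) @ q \<in> legs V E" using path_extends_to_leg by blast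
    moreover have "p = butlast p @ [u]" using append_butlast_last_id[OF ne] p(3) by simp
    ultimately have "butlast p @ u # w # q \<in> legs V E"
      by (metis append.assoc append_Cons append_Nil)
    then show ?thesis using path_edges_append[of u w "butlast p" q] w(1) by auto
  qed
next
  fix e assume "e \<in> (\<Union>p\<in>legs V E. set (path_edges p))"
  then show "e \<in> E" using path_edges_subset by (fastforce simp: legs_def)
qed

lemma vertices_of_legs: "V = insert c (\<Union>p\<in>legs V E. set (tl p))"
proof (intro equalityI subsetI)
  fix v assume "v \<in> V"
  then obtain p where p: "graph_path V E p" "hd p = c" "last p = v" by (rule path_from_center)
  then obtain q where q: "p @ q \<in> legs V E" using path_extends_to_leg by blast
  have "p = c # tl p" "v \<in> set p" using p by (auto simp: graph_path_def)
  then have "v = c \<or> v \<in> set (tl (p @ q))"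
    by (metis Un_iff append_Cons list.sel(3) set_ConsD set_append)
  then show "v \<in> insert c (\<Union>p\<in>legs V E. set (tl p))" using q by blast
next
  fix v assume "v \<in> insert c (\<Union>p\<in>legs V E. set (tl p))"
  then show "v \<in> V" using c_V by (auto simp: legs_def graph_path_def dest: list.set_sel(2))
qed

lemma leg_Cons:
  assumes "p \<in> legs V E"
  shows "p = c # tl p" "tl p \<noteq> []" "graph_path V E p" "leaf V E (last p)"
proof -
  have p: "graph_path V E p" "hd p = c" "leaf V E (last p)"
    using assms center_unique by (auto simp: legs_def)
  then show "graph_path V E p" "leaf V E (last p)" by auto
  show *: "p = c # tl p" using p by (auto simp: graph_path_def)
  show "tl p \<noteq> []"
  proof
    assume "tl p = []"
    then have "last p = c" using * by (metis last.simps)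
    then show False using p deg_c by (simp add: leaf_def)
  qed
qed

lemma leg_not_prefix:
  assumes "p \<in> legs V E" "p @ y # ys \<in> legs V E"
  shows False
proof -
  have "butlast p \<noteq> []" using leg_Cons[OF assms(1)] by (metis butlast.simps(2) list.discI)
  then have p: "p = butlast (butlast p) @ [last (butlast p), last p]"
    by (metis append.assoc append_Cons append_Nil append_butlast_last_id butlast.simps(1))
  define x w where "x = last (butlast p)" and "w = last p"
  have "graph_path V E (butlast (butlast p) @ x # w # y # ys)"
    using leg_Cons(3)[OF assms(2)] p unfolding x_def w_def
    by (metis append.assoc append_Cons append_Nil)
  then have g: "graph_path V E (x # w # y # ys)"
    by (cases "butlast (butlast p) = []") (auto simp: graph_path_append_iff)
  then have "card {{x, w}, {w, y}} \<le> vert_degree E w"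
    by (intro card_incident_le) (auto simp: graph_path_Cons_Cons)
  moreover have "{x, w} \<noteq> {w, y}" using g by (auto simp: graph_path_def doubleton_eq_iff)
  moreover have "vert_degree E w = 1" using leg_Cons(4)[OF assms(1)] by (simp add: leaf_def w_def)
  ultimately show False by simp
qed

lemma legs_diverge_at_center:
  assumes "p \<in> legs V E" "q \<in> legs V E" "p \<noteq> q"
  shows "hd (tl p) \<noteq> hd (tl q)"
proof -
  obtain ps xs ys where ps: "p = ps @ xs" "q = ps @ ys" "xs = [] \<or> ys = [] \<or> hd xs \<noteq> hd ys"
    using longest_common_prefix[of p q] by blast
  have "xs \<noteq> []"
    using leg_not_prefix[of p] assms ps by (cases ys) auto
  moreover have "ys \<noteq> []"
    using leg_not_prefix[of q] assms ps by (cases xs) auto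
  ultimately obtain x xs' y ys' where xy: "xs = x # xs'" "ys = y # ys'" "x \<noteq> y"
    using ps(3) by (cases xs; cases ys) auto
  note P = leg_Cons[OF assms(1)] and Q = leg_Cons[OF assms(2)]
  have "ps \<noteq> []"
    using P(1) Q(1) ps xy by (metis append_Nil list.sel(1))
  have "butlast ps = []"
  proof (rule ccontr)
    assume "butlast ps \<noteq> []"
    then have pse: "ps = butlast (butlast ps) @ [last (butlast ps), last ps]"
      by (metis append.assoc append_Cons append_Nil append_butlast_last_id butlast.simps(1))
    define z w r where "z = last (butlast ps)" and "w = last ps" and "r = butlast (butlast ps)"
    have p: "p = r @ z # w # x # xs'" and q: "q = r @ z # w # y # ys'"
      using ps xy pse unfolding z_def w_def r_def
      by (metis append.assoc append_Cons append_Nil)+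
    have gp: "graph_path V E (z # w # x # xs')"
      using P(3) unfolding p by (cases "r = []") (auto simp: graph_path_append_iff)
    have gq: "graph_path V E (z # w # y # ys')"
      using Q(3) unfolding q by (cases "r = []") (auto simp: graph_path_append_iff)
    have "card {{z, w}, {w, x}, {w, y}} \<le> vert_degree E w"
      using gp gq by (intro card_incident_le) (auto simp: graph_path_Cons_Cons)
    moreover have "card {{z, w}, {w, x}, {w, y}} = 3"
      using gp gq xy(3) by (auto simp: graph_path_def doubleton_eq_iff)
    ultimately have "spider_center V E w"
      using gp by (auto simp: spider_center_def graph_path_def)
    then have "w = c" by (rule center_unique)
    moreover have "hd p \<noteq> w"
      using P(3) unfolding p by (cases r) (auto simp: graph_path_def)
    ultimately show False using P(1) by (metis list.sel(1))
  qed
  then obtain d where "ps = [d]" using \<open>ps \<noteq> []\<close> by (metis append_Nil append_butlast_last_id)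
  then show ?thesis using ps xy by simp
qed

lemma legs_disjoint:
  assumes "p \<in> legs V E" "q \<in> legs V E" "p \<noteq> q"
  shows "set (tl p) \<inter> set (tl q) = {}"
proof (rule ccontr)
  assume "\<not> ?thesis"
  then have "\<exists>v\<in>set (tl p). v \<in> set (tl q)" by blast
  then obtain A v B where A: "tl p = A @ v # B" "v \<in> set (tl q)" "\<forall>a\<in>set A. a \<notin> set (tl q)"
    by (rule split_list_first_propE)
  obtain C D where C: "tl q = C @ v # D" using A(2) by (meson split_list)
  have "graph_path V E ((c # A) @ v # B)" "graph_path V E ((c # C @ [v]) @ D)"
    using leg_Cons(1,3)[OF assms(1)] leg_Cons(1,3)[OF assms(2)] A(1) C by auto
  then have gA: "graph_path V E (c # A)" "{last (c # A), v} \<in> E" "v \<notin> set (c # A)"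
    and gC: "graph_path V E (c # C @ [v])"
    using graph_path_append_iff[of "c # A" "v # B" V E] graph_path_append_iff[of "c # C @ [v]" D V E]
    by (cases "D = []"; auto)+
  have gC': "graph_path V E (C @ [v])" "{c, hd (C @ [v])} \<in> E" "c \<notin> set (C @ [v])"
    using gC by (cases C; auto simp: graph_path_Cons_Cons)+
  have "graph_path V E (v # rev C)" using gC'(1) graph_path_rev[of V E "C @ [v]"] by simp
  moreover have "set (c # A) \<inter> set (v # rev C) = {}"
    using gA(3) gC'(3) A(3) C by auto
  ultimately have "graph_path V E ((c # A) @ v # rev C)"
    using gA graph_path_append_iff[of "c # A" "v # rev C" V E] by auto
  moreover have "last ((c # A) @ v # rev C) = hd (C @ [v])"
    by (cases C) auto
  moreover have "\<not> (A = [] \<and> C = [])"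
    using legs_diverge_at_center[OF assms] A(1) C by auto
  then have "length ((c # A) @ v # rev C) \<ge> 3" by (cases A; cases C) auto
  ultimately have "graph_cycle V E ((c # A) @ v # rev C)"
    using gC'(2) by (simp add: graph_cycle_def insert_commute)
  then show False using tree by (auto simp: tree_graph_def)
qed

lemma finite_legs: "finite (legs V E)"
  by (rule finite_subset[OF _ finite_subset_distinct[OF fin_V]])
    (auto simp: legs_def graph_path_def)

lemma distinct_leg_vertices:
  assumes "distinct P" "set P = legs V E"
  shows "distinct (c # concat (map tl P))"
proof -
  have "inj_on tl (legs V E)" by (rule inj_onI) (metis leg_Cons(1))
  then have "distinct (map tl P)" using assms by (simp add: distinct_map)
  moreover have "distinct (tl p) \<and> c \<notin> set (tl p)" if "p \<in> set P" for p
    using leg_Cons(1,3)[of p] that assms(2) by (cases p) (auto simp: graph_path_def)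
  then have "distinct xs \<and> c \<notin> set xs" if "xs \<in> set (map tl P)" for xs
    using that by auto
  moreover have "set xs \<inter> set ys = {}"
    if "xs \<in> set (map tl P)" "ys \<in> set (map tl P)" "xs \<noteq> ys" for xs ys
  proof -
    obtain p q where "xs = tl p" "ys = tl q" "p \<in> legs V E" "q \<in> legs V E"
      using \<open>xs \<in> _\<close> \<open>ys \<in> _\<close> assms(2) by auto
    then show ?thesis using legs_disjoint \<open>xs \<noteq> ys\<close> by blast
  qed
  ultimately show ?thesis
    by (auto intro!: distinct_concat simp del: set_map)
qed

end

lemma exists_map_eq:
  "length xs = length ys \<Longrightarrow> distinct xs \<Longrightarrow> \<exists>f. map f xs = ys"
proof (induction xs ys rule: list_induct2)
  case (Cons x xs y ys)
  then obtain f where "map f xs = ys" by auto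
  then have "map (f(x := y)) (x # xs) = y # ys" using Cons.prems by auto
  then show ?case by (rule exI[of _ "f(x := y)"])
qed simp

lemma path_diffs_map_path_edges:
  "path_diffs (map f p) = map (\<lambda>e. Max (f ` e) - Min (f ` e)) (path_edges p)"
  by (induction p rule: path_edges.induct) (auto simp: max_def min_def)

lemma exists_mset_map_eq:
  "mset (map f xs) = mset ys \<Longrightarrow> \<exists>xs'. mset xs' = mset xs \<and> map f xs' = ys"
proof (induction ys arbitrary: xs)
  case (Cons y ys)
  then have "y \<in> set (map f xs)" by (metis list.set_intros(1) set_mset_mset)
  then obtain x where x: "x \<in> set xs" "y = f x" by auto
  then obtain as bs where xs: "xs = as @ x # bs" by (meson split_list)
  then have "mset (map f (as @ bs)) = mset ys" using Cons.prems x by simp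
  then obtain xs' where "mset xs' = mset (as @ bs)" "map f xs' = ys" using Cons.IH by blast
  then show ?case using xs x by (intro exI[of _ "x # xs'"]) simp
qed simp

lemma mset_ones_twos:
  "\<forall>x\<in>set xs. x = 1 \<or> x = (2::nat) \<Longrightarrow> \<exists>l m. mset xs = replicate_mset l 1 + replicate_mset m 2"
proof (induction xs)
  case (Cons x xs)
  then obtain l m where lm: "mset xs = replicate_mset l 1 + replicate_mset m 2" by auto
  show ?case
  proof (cases "x = 1")
    case True
    then show ?thesis using lm by (intro exI[of _ "Suc l"] exI[of _ m]) simp
  next
    case False
    then have "x = 2" using Cons.prems by simp
    then show ?thesis using lm by (intro exI[of _ l] exI[of _ "Suc m"]) simp
  qed
qed simp

lemma (in centered_spider) graceful_if_labelable:
  assumes "distinct P" "set P = legs V E" "labelable (mset (map path_length P))"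
  shows "graceful V E"
proof -
  obtain z L0 where "mset (map length L0) = mset (map path_length P)" "spider_labeling z L0"
    using assms(3) unfolding labelable_def by blast
  then obtain L where L: "map length L = map path_length P" "spider_labeling z L"
    using exists_mset_map_eq spider_labeling_cong_mset by metis
  have tl_len: "map length L = map length (map tl P)"
    using L(1) by (simp add: path_length_def o_def)
  let ?W = "c # concat (map tl P)"
  define n where "n = length (concat L)"
  have lenW: "length ?W = length (z # concat L)"
    using tl_len by (simp add: length_concat o_def)
  have dW: "distinct ?W" using distinct_leg_vertices assms by blast
  have V: "V = set ?W" using vertices_of_legs assms(2) by simp
  obtain f where f: "map f ?W = z # concat L" using exists_map_eq[OF lenW dW] by (elim exE)
  then have fc: "f c = z" and fcc: "concat (map (map f) (map tl P)) = concat L"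
    by (auto simp: map_concat)
  have lenL: "length L = length P" using tl_len by (metis length_map)
  have nth: "length (L ! i) = length (tl (P ! i))" if "i < length P" for i
    using arg_cong[OF tl_len, of "\<lambda>xs. xs ! i"] that lenL by simp
  have mL: "map (map f) (map tl P) = L"
  proof (rule concat_injective[OF fcc])
    show "length (map (map f) (map tl P)) = length L" using lenL by simp
    show "\<forall>(x, y)\<in>set (zip (map (map f) (map tl P)) L). length x = length y"
      using nth lenL by (auto simp: set_zip)
  qed
  have setL: "set L = (\<lambda>p. map f (tl p)) ` set P"
    unfolding mL[symmetric] by (simp add: image_image)
  let ?h = "\<lambda>e. Max (f ` e) - Min (f ` e)"
  have "{1..int n} = (\<Union>l\<in>set L. set (path_diffs (z # l)))"
    using L(2) unfolding spider_labeling_def n_def by simp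
  also have "\<dots> = (\<Union>p\<in>legs V E. set (path_diffs (map f p)))"
  proof -
    have "z # map f (tl p) = map f p" if "p \<in> legs V E" for p
      using leg_Cons(1)[OF that] fc by (cases p) auto
    then show ?thesis using setL assms(2) by simp
  qed
  also have "\<dots> = ?h ` (\<Union>p\<in>legs V E. set (path_edges p))"
    by (simp add: path_diffs_map_path_edges image_UN)
  also have "\<dots> = ?h ` E" using edges_of_legs by simp
  finally have hE: "?h ` E = {1..int n}" by simp
  have "card E \<le> n"
  proof -
    have "E = set (concat (map path_edges P))" using edges_of_legs assms(2) by simp
    then have "card E \<le> length (concat (map path_edges P))" by (metis card_length)
    also have "\<dots> = n"
      using tl_len by (simp add: n_def length_concat o_def length_path_edges)
    finally show ?thesis .
  qed
  moreover have "n \<le> card E" using card_image_le[OF fin_E, of ?h] hE by simp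
  ultimately have n: "card E = n" by simp
  have "{\<bar>f x - f y\<bar> | x y. {x, y} \<in> E} = ?h ` E"
  proof -
    have h: "?h {x, y} = \<bar>f x - f y\<bar>" for x y by (auto simp: max_def min_def)
    have "\<exists>x y. e = {x, y}" if "e \<in> E" for e using edgeD[OF that] by (auto simp: card_2_iff)
    then show ?thesis using h by (auto simp: image_iff) (metis h)+
  qed
  moreover have "inj_on f V"
    using spider_labeling_distinct[OF L(2)] f V by (metis distinct_map)
  moreover have "f ` V = {0..int n}"
    using L(2) V f unfolding spider_labeling_def n_def by (metis list.set_map)
  ultimately have "graceful_labeling V E f"
    using n hE by (simp add: graceful_labeling_def)
  then show ?thesis unfolding graceful_def by blast
qed

theorem theorem1p6:
  fixes V :: "'a set" and E :: "'a set set"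
  assumes "spider V E"
    and "\<exists>L \<subseteq> legs V E. card L = 3 \<and> (\<forall>p \<in> legs V E - L. path_length p \<le> 2)"
  shows "graceful V E"
proof -
  obtain L where L: "L \<subseteq> legs V E" "card L = 3" "\<forall>p \<in> legs V E - L. path_length p \<le> 2"
    using assms(2) by blast
  obtain p q r where pqr: "L = {p, q, r}" "p \<noteq> q" "q \<noteq> r" "p \<noteq> r"
    using L(2) by (auto simp: card_3_iff)
  then have "p \<in> legs V E" using L(1) by blast
  then have "spider_center V E (hd p)" by (simp add: legs_def)
  then interpret centered_spider V E "hd p"
    using assms(1) by unfold_locales
  obtain Q where Q: "set Q = legs V E - L" "distinct Q"
    using finite_legs finite_distinct_list[of "legs V E - L"] by auto
  have len: "path_length s \<ge> 1" if "s \<in> legs V E" for s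
    using leg_Cons(2)[OF that] by (cases s) (auto simp: path_length_def Suc_le_eq)
  have "\<forall>x\<in>set (map path_length Q). x = 1 \<or> x = 2"
  proof
    fix x assume "x \<in> set (map path_length Q)"
    then obtain s where "s \<in> legs V E - L" "x = path_length s" using Q(1) by auto
    then have "1 \<le> x" "x \<le> 2" using len L(3) by auto
    then show "x = 1 \<or> x = 2" by linarith
  qed
  then obtain l m where "mset (map path_length Q) = replicate_mset l 1 + replicate_mset m 2"
    using mset_ones_twos by blast
  then have "mset (map path_length ([p, q, r] @ Q)) =
      {#path_length p, path_length q, path_length r#} + replicate_mset l 1 + replicate_mset m 2"
    by simp
  moreover have "labelable ({#path_length p, path_length q, path_length r#} +
      replicate_mset l 1 + replicate_mset m 2)"
    using len L(1) pqr by (intro labelable_three) auto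
  ultimately have "labelable (mset (map path_length ([p, q, r] @ Q)))" by simp
  moreover have "distinct ([p, q, r] @ Q)" "set ([p, q, r] @ Q) = legs V E"
    using Q L(1) pqr by auto
  ultimately show ?thesis using graceful_if_labelable by blast
qed

end
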